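(* There exist absolute constants $0<c\le C<\infty$ such that the following holds. Let $\tau=\{t_k\}_{k=1}^{\infty}$ be a sequence of real numbers with $t_k\in[0,1]$ for all $k$ and $t_1>0$. Then $$\inf\Bigl\{\sum_{n=1}^{\infty}a_n^2 : a_n\sum_{k=1}^{n}a_k\ge t_n\ \text{for all } n\in\mathbb{N}\Bigr\}\asymp\inf\Bigl\{\sum_{n=1}^{\infty}\Bigl(\sum_{k=1}^{n}u_k\Bigr)^{-1}u_n^2 : u_n\ge t_n\ \text{for all } n\in\mathbb{N}\Bigr\}\asymp\sum_{n=1}^{\infty}\Bigl(n\sum_{k=1}^{n}t_k^2\Bigr)^{-1/2}t_n^2,$$ where the infima are over real sequences $\{a_n\}_{n=1}^{\infty}$ and $\{u_n\}_{n=1}^{\infty}$, respectively, and $A\asymp B$ means $cB\le A\le CB$.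
   Context: $\mathbb{N}=\{1,2,\dots\}$. All sums are of nonnegative terms and, like the infima, take values in $[0,+\infty]$; in particular, if one of the three expressions is infinite, then so are the others. *)

theory Defs
  imports "HOL-Analysis.Analysis"
begin

(* Sequences indexed by 1, 2, ... are functions on nat whose value at 0 is never used;
   the series over n >= 1 are therefore shifted by Suc. Series are taken in ennreal so that
   they may diverge; ennreal sends negative reals to 0, but under the constraints below,
   with t nonnegative and t 1 > 0, every term is a nonnegative real. *)

definition product_inf :: "(nat \<Rightarrow> real) \<Rightarrow> ennreal" where
  "product_inf t =
     (INF a \<in> {a :: nat \<Rightarrow> real. \<forall>n\<ge>1. a n * (\<Sum>k=1..n. a k) \<ge> t n}.
        \<Sum>n. ennreal ((a (Suc n))\<^sup>2))"

definition majorant_inf :: "(nat \<Rightarrow> real) \<Rightarrow> ennreal" where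
  "majorant_inf t =
     (INF u \<in> {u :: nat \<Rightarrow> real. \<forall>n\<ge>1. u n \<ge> t n}.
        \<Sum>n. ennreal (inverse (\<Sum>k=1..Suc n. u k) * (u (Suc n))\<^sup>2))"

definition explicit_sum :: "(nat \<Rightarrow> real) \<Rightarrow> ennreal" where
  "explicit_sum t =
     (\<Sum>n. ennreal ((real (Suc n) * (\<Sum>k=1..Suc n. (t k)\<^sup>2)) powr (-1/2) * (t (Suc n))\<^sup>2))"

definition comparable :: "real \<Rightarrow> real \<Rightarrow> ennreal \<Rightarrow> ennreal \<Rightarrow> bool" where
  "comparable c C A B \<longleftrightarrow> ennreal c * B \<le> A \<and> A \<le> ennreal C * B"

end

theory Submission
  imports Defs
begin

text \<open>
  Write $P$, $M$, $E$ for the three expressions and $U_n$, $T_n$ for the partial sums of $u_k$ and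
  $t_k^2$.  The proof gives $P \le M \le 2P$ and $\frac12 E \le M \le 16 E$.

  The comparison of $P$ with $M$ is the discrete form of the substitution $u = a A$, where
  $A_n = a_1 + \dots + a_n$: morally $u = (A^2/2)'$, so $A = \sqrt{2U}$ and $a^2$ is $u^2/U$ up to a
  constant. From $a$ one takes $u_n = |a_n| \sum_{k \le n} |a_k|$, from $u$ one takes
  $a_n = u_n/\sqrt{U_n}$ (\<open>half_majorant_inf_le_product_inf\<close>,
  \<open>product_inf_le_majorant_inf\<close>).

  For $E \le 2M$, the Cauchy--Schwarz inequality $U_n \le (n \sum_{k \le n} u_k^2)^{1/2}$ bounds the
  explicit sum of $u$ by $\sum u_n^2/U_n$, so one needs that replacing $t$ by a majorant
  $u$ cannot decrease the explicit sum by more than a constant factor.  Its terms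
  $t_n^2/\sqrt{T_n}$ are comparable to the increments of $\sqrt{T_n}$, and summation by parts writes
  $\sum n^{-1/2} (\sqrt{T_n} - \sqrt{T_{n-1}})$ as a combination of the $\sqrt{T_n}$ with nonnegative
  weights, which is monotone in $T$ (\<open>explicit_partial_sum_quasi_mono\<close>).

  For $M \le 16E$ a good majorant has to be built when $E$ is finite.  The choice $u = t$ may be bad,
  because $T_n$ can be dominated by late entries, and then $\sum_{k \le n} t_k$ is much smaller than
  $\sqrt{n T_n}$.  The remedy is to anticipate these entries.  With $w_m$ the $m$-th term of $E$, let
  $u_k = t_k + v_k$ and $v_k = \sum_m w_m \varphi(k/m)$, where $\varphi(x) = \min(x, x^{-1/2})$.
  After the peak $m$, the partial sums of one profile are at least $\sqrt{mn}/2$; hence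
  $\sum_{k \le n} v_k \ge \frac12 \sqrt n \sum_{m \le n} t_m^2/\sqrt{T_m} \ge \frac12 \sqrt{n T_n}$,
  which makes the contribution of $t$ to $\sum u_n^2/U_n$ at most a multiple of $E$.  The contribution
  of $v$ is controlled because the profile has a cost $\sum_k \varphi(k/m)^2/\sum_{j \le k} \varphi(j/m)$
  bounded independently of $m$ (\<open>profile_cost_bound\<close>), and because $(x, y) \mapsto x^2/y$ is
  subadditive, so that costs of superposed profiles add up to at most $6 \sum w_m = 6E$
  (\<open>superposed_profiles\<close>).
\<close>

section \<open>Nonnegative series and elementary facts\<close>

lemma suminf_ennreal_le_of_partial_sums:
  fixes f :: "nat \<Rightarrow> real" and B :: ennreal
  assumes "\<And>n. 0 \<le> f n" and "\<And>N. ennreal (\<Sum>n<N. f n) \<le> B"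
  shows "(\<Sum>n. ennreal (f n)) \<le> B"
proof (rule suminf_le_const)
  fix N
  show "(\<Sum>n<N. ennreal (f n)) \<le> B"
    using assms by (simp add: sum_ennreal)
qed (rule summableI)

lemma suminf_ennreal_le_cmult:
  fixes f g :: "nat \<Rightarrow> real"
  assumes f: "\<And>n. 0 \<le> f n" and g: "\<And>n. 0 \<le> g n" and c: "0 \<le> c"
    and le: "\<And>N. (\<Sum>n<N. f n) \<le> c * (\<Sum>n<N. g n)"
  shows "(\<Sum>n. ennreal (f n)) \<le> ennreal c * (\<Sum>n. ennreal (g n))"
proof (rule suminf_ennreal_le_of_partial_sums[OF f])
  fix N
  have "ennreal (\<Sum>n<N. f n) \<le> ennreal (c * (\<Sum>n<N. g n))"
    by (rule ennreal_leI[OF le])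
  also have "\<dots> = ennreal c * (\<Sum>n<N. ennreal (g n))"
    using c g by (simp add: ennreal_mult sum_nonneg sum_ennreal)
  also have "\<dots> \<le> ennreal c * (\<Sum>n. ennreal (g n))"
    by (intro mult_left_mono sum_le_suminf) (auto simp: summableI)
  finally show "ennreal (\<Sum>n<N. f n) \<le> ennreal c * (\<Sum>n. ennreal (g n))" .
qed

lemma ennreal_half_mult_le:
  assumes "A \<le> ennreal 2 * B"
  shows "ennreal (1/2) * A \<le> B"
proof -
  have "ennreal (1/2) * A \<le> ennreal (1/2) * (ennreal 2 * B)"
    by (rule mult_left_mono[OF assms]) simp
  also have "\<dots> = ennreal (1/2 * 2) * B"
    by (simp only: ennreal_mult mult.assoc)
  finally show ?thesis by simp
qed

lemma sum_pos_of_first: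
  fixes x :: "nat \<Rightarrow> real"
  assumes "\<And>k. 1 \<le> k \<Longrightarrow> 0 \<le> x k" and "0 < x 1" and "1 \<le> n"
  shows "0 < (\<Sum>k=1..n. x k)"
  by (rule sum_pos2[of _ 1]) (use assms in auto)

lemma powr_minus_half:
  fixes x :: real
  assumes "0 < x"
  shows "x powr (-1/2) = 1 / sqrt x"
proof -
  have "x powr (-1/2) = inverse (x powr (1/2))"
    unfolding powr_minus[symmetric] by simp
  also have "\<dots> = 1 / sqrt x"
    unfolding powr_half_sqrt[OF less_imp_le[OF assms]] by (rule inverse_eq_divide)
  finally show ?thesis .
qed

section \<open>Products and majorants\<close>

text \<open>
  Since $U$ is nondecreasing, the sequence $a_k = u_k/\sqrt{U_k}$ satisfies
  $\sum_{k \le n} a_k \ge U_n/\sqrt{U_n} = \sqrt{U_n}$, hence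
  $a_n \sum_{k \le n} a_k \ge u_n$, while $a_n^2$ is exactly $u_n^2/U_n$.
\<close>

lemma product_inf_le_majorant_inf:
  assumes t: "\<forall>k\<ge>1. 0 \<le> t k" and t1: "0 < t 1"
  shows "product_inf t \<le> majorant_inf t"
  unfolding majorant_inf_def
proof (rule INF_greatest)
  fix u :: "nat \<Rightarrow> real"
  assume "u \<in> {u. \<forall>n\<ge>1. t n \<le> u n}"
  hence ut: "\<And>n. 1 \<le> n \<Longrightarrow> t n \<le> u n" by auto
  have u0: "0 \<le> u n" if "1 \<le> n" for n
    by (rule order_trans[OF _ ut[OF that]]) (use t that in blast)
  define U where "U n = (\<Sum>k=1..n. u k)" for n
  have Upos: "0 < U n" if "1 \<le> n" for n
    unfolding U_def by (rule sum_pos_of_first) (use u0 ut[of 1] t1 that in auto)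
  have Umono: "U k \<le> U n" if "k \<le> n" for k n
    unfolding U_def by (rule sum_mono2) (use u0 that in auto)
  define a where "a n = u n / sqrt (U n)" for n
  have "t n \<le> a n * (\<Sum>k=1..n. a k)" if n: "1 \<le> n" for n
  proof -
    have "sqrt (U n) = U n / sqrt (U n)"
      using Upos[OF n] by (simp add: real_div_sqrt)
    also have "\<dots> = (\<Sum>k=1..n. u k / sqrt (U n))"
      by (subst (1) U_def) (rule sum_divide_distrib)
    also have "\<dots> \<le> (\<Sum>k=1..n. a k)"
      unfolding a_def by (intro sum_mono divide_left_mono real_sqrt_le_mono Umono)
        (use u0 Upos n in \<open>auto intro!: mult_pos_pos\<close>)
    finally have "a n * sqrt (U n) \<le> a n * (\<Sum>k=1..n. a k)"
      by (intro mult_left_mono) (use u0[OF n] Upos[OF n] in \<open>auto simp: a_def\<close>)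
    moreover have "a n * sqrt (U n) = u n"
      using Upos[OF n] by (simp add: a_def)
    ultimately show ?thesis using ut[OF n] by linarith
  qed
  hence "product_inf t \<le> (\<Sum>n. ennreal ((a (Suc n))\<^sup>2))"
    unfolding product_inf_def by (intro INF_lower) auto
  also have "(\<lambda>n. (a (Suc n))\<^sup>2) = (\<lambda>n. inverse (\<Sum>k=1..Suc n. u k) * (u (Suc n))\<^sup>2)"
  proof
    fix n
    have "(a (Suc n))\<^sup>2 = (u (Suc n))\<^sup>2 / U (Suc n)"
      using Upos[of "Suc n"] by (simp add: a_def power_divide)
    thus "(a (Suc n))\<^sup>2 = inverse (\<Sum>k=1..Suc n. u k) * (u (Suc n))\<^sup>2"
      by (simp only: U_def divide_inverse_commute)
  qed
  finally show "product_inf t \<le> (\<Sum>n. ennreal (inverse (\<Sum>k=1..Suc n. u k) * (u (Suc n))\<^sup>2))" .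
qed

text \<open>
  The discrete form of $(A^2)' = 2 A A'$: one has $A_n^2 - A_{n-1}^2 = a_n (A_n + A_{n-1})$, which
  differs from $2 a_n A_n$ by the square $a_n^2$.
\<close>

lemma square_sum_le_twice_sum_mult_sum:
  fixes x :: "nat \<Rightarrow> real"
  shows "(\<Sum>k=1..n. x k)\<^sup>2 \<le> 2 * (\<Sum>k=1..n. x k * (\<Sum>j=1..k. x j))"
proof (induction n)
  case (Suc n)
  define s where "s = (\<Sum>k=1..n. x k)"
  have "(s + x (Suc n))\<^sup>2 \<le> s\<^sup>2 + 2 * (x (Suc n) * (s + x (Suc n)))"
    by (simp add: power2_eq_square algebra_simps)
  with Suc show ?case by (simp add: s_def algebra_simps)
qed simp

text \<open>
  Passing to absolute values preserves the constraint and the cost.  With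
  $A_n = \sum_{k \le n} |a_k|$ and $u_n = |a_n| A_n$ one gets $U_n \ge A_n^2/2$, so
  $u_n^2/U_n \le 2 a_n^2$.
\<close>

lemma half_majorant_inf_le_product_inf:
  assumes t: "\<forall>k\<ge>1. 0 \<le> t k" and t1: "0 < t 1"
  shows "ennreal (1/2) * majorant_inf t \<le> product_inf t"
  unfolding product_inf_def
proof (intro INF_greatest ennreal_half_mult_le)
  fix a :: "nat \<Rightarrow> real"
  assume "a \<in> {a. \<forall>n\<ge>1. t n \<le> a n * (\<Sum>k=1..n. a k)}"
  hence a: "t n \<le> a n * (\<Sum>k=1..n. a k)" if "1 \<le> n" for n using that by blast
  define A where "A n = (\<Sum>k=1..n. \<bar>a k\<bar>)" for n
  define u where "u n = \<bar>a n\<bar> * A n" for n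
  define U where "U n = (\<Sum>k=1..n. u k)" for n
  have A0: "0 \<le> A n" for n by (simp add: A_def sum_nonneg)
  have ut: "t n \<le> u n" if "1 \<le> n" for n
  proof -
    have "t n \<le> \<bar>a n * (\<Sum>k=1..n. a k)\<bar>" using a[OF that] by linarith
    also have "\<dots> \<le> u n"
      unfolding u_def A_def abs_mult by (intro mult_left_mono sum_abs) auto
    finally show ?thesis .
  qed
  have "a 1 \<noteq> 0" using a[of 1] t1 by auto
  hence a1: "0 < \<bar>a 1\<bar>" by simp
  have Apos: "0 < A n" if "1 \<le> n" for n
    unfolding A_def by (rule sum_pos_of_first) (use a1 that in auto)
  have AU: "(A n)\<^sup>2 \<le> 2 * U n" for n
    using square_sum_le_twice_sum_mult_sum[of "\<lambda>k. \<bar>a k\<bar>" n]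
    by (simp add: A_def u_def U_def)
  have cost_le: "inverse (U n) * (u n)\<^sup>2 \<le> 2 * (a n)\<^sup>2" if "1 \<le> n" for n
  proof -
    have A2: "0 < (A n)\<^sup>2" using Apos[OF that] by simp
    have Up: "0 < U n" using AU[of n] A2 by linarith
    have "(u n)\<^sup>2 = (a n)\<^sup>2 * (A n)\<^sup>2" by (simp add: u_def power_mult_distrib)
    also have "\<dots> \<le> (a n)\<^sup>2 * (2 * U n)" by (intro mult_left_mono AU) auto
    finally show ?thesis using Up by (simp add: field_simps)
  qed
  have U0: "0 \<le> U n" for n
    using AU[of n] zero_le_power2[of "A n"] by linarith
  have "majorant_inf t \<le> (\<Sum>n. ennreal (inverse (U (Suc n)) * (u (Suc n))\<^sup>2))"
    unfolding majorant_inf_def U_def by (intro INF_lower) (use ut in auto)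
  also have "\<dots> \<le> ennreal 2 * (\<Sum>n. ennreal ((a (Suc n))\<^sup>2))"
  proof (rule suminf_ennreal_le_cmult)
    fix N
    show "(\<Sum>n<N. inverse (U (Suc n)) * (u (Suc n))\<^sup>2) \<le> 2 * (\<Sum>n<N. (a (Suc n))\<^sup>2)"
      unfolding sum_distrib_left by (intro sum_mono cost_le) simp
  qed (use U0 in auto)
  finally show "majorant_inf t \<le> ennreal 2 * (\<Sum>n. ennreal ((a (Suc n))\<^sup>2))" .
qed

section \<open>The explicit sum is at most twice the infimum over majorants\<close>

text \<open>
  Summation by parts, reduced to its consequence: for a nonnegative decreasing weight $b$, the
  quantity $\sum_n (d_{n+1} - d_n) b_n$ is nonnegative whenever $d \ge 0$ starts at $0$, although
  $d$ itself may oscillate.  The bound $d_N b_N$ in place of $0$ makes the induction work.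
\<close>

lemma sum_increments_mult_decseq_ge:
  fixes d b :: "nat \<Rightarrow> real"
  assumes d0: "d 0 = 0" and d: "\<And>n. 0 \<le> d n" and b: "decseq b"
  shows "d N * b N \<le> (\<Sum>n<N. (d (Suc n) - d n) * b n)"
proof (induction N)
  case (Suc N)
  have "d (Suc N) * b (Suc N) \<le> d (Suc N) * b N"
    by (intro mult_left_mono d) (use b in \<open>auto simp: decseq_Suc_iff\<close>)
  with Suc show ?case by (simp add: algebra_simps)
qed (use d0 in simp)

lemma sqrt_increment_bounds:
  fixes S s :: real
  assumes "0 \<le> S" "0 \<le> s" "0 < S + s"
  shows "sqrt (S + s) - sqrt S \<le> s / sqrt (S + s)"
    and "s / sqrt (S + s) \<le> 2 * (sqrt (S + s) - sqrt S)"
proof -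
  define x y where "x = sqrt S" and "y = sqrt (S + s)"
  have xy: "0 \<le> x" "x \<le> y" "0 < y" using assms by (auto simp: x_def y_def)
  have s: "s = (y - x) * (y + x)"
  proof -
    have "x * x = S" "y * y = S + s" using assms by (auto simp: x_def y_def)
    thus ?thesis by (simp add: algebra_simps)
  qed
  have "(y - x) * y \<le> (y - x) * (y + x)" "(y - x) * (y + x) \<le> (y - x) * (2 * y)"
    by (intro mult_left_mono; use xy in simp)+
  hence "y - x \<le> s / y" "s / y \<le> 2 * (y - x)"
    using xy unfolding s by (simp_all add: field_simps)
  thus "sqrt (S + s) - sqrt S \<le> s / sqrt (S + s)"
    "s / sqrt (S + s) \<le> 2 * (sqrt (S + s) - sqrt S)"
    by (simp_all add: x_def y_def)
qed

text \<open>
  The terms $t_n^2/\sqrt{T_n}$ are within a factor $2$ of the increments of $\sqrt{T_n}$, and summation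
  by parts applied to $d_n = \sqrt{Q_n} - \sqrt{T_n} \ge 0$ with weights $n^{-1/2}$ compares the
  sums of the increments for $t$ and for $u$.  Termwise comparison is impossible, since a larger
  early entry of $u$ increases all later denominators.
\<close>

lemma explicit_partial_sum_quasi_mono:
  fixes t u :: "nat \<Rightarrow> real"
  assumes t: "\<And>k. 1 \<le> k \<Longrightarrow> 0 \<le> t k" and t1: "0 < t 1"
    and ut: "\<And>k. 1 \<le> k \<Longrightarrow> t k \<le> u k"
  shows "(\<Sum>n<N. (t (Suc n))\<^sup>2 / sqrt (real (Suc n) * (\<Sum>k=1..Suc n. (t k)\<^sup>2)))
    \<le> 2 * (\<Sum>n<N. (u (Suc n))\<^sup>2 / sqrt (real (Suc n) * (\<Sum>k=1..Suc n. (u k)\<^sup>2)))"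
proof -
  define T where "T n = (\<Sum>k=1..n. (t k)\<^sup>2)" for n
  define Q where "Q n = (\<Sum>k=1..n. (u k)\<^sup>2)" for n
  define b where "b n = 1 / sqrt (real (Suc n))" for n
  have T0: "0 \<le> T n" and Q0: "0 \<le> Q n" for n
    by (simp_all add: T_def Q_def sum_nonneg)
  have TS: "T (Suc n) = T n + (t (Suc n))\<^sup>2" and QS: "Q (Suc n) = Q n + (u (Suc n))\<^sup>2" for n
    by (simp_all add: T_def Q_def)
  have TQ: "T n \<le> Q n" for n
    unfolding T_def Q_def by (intro sum_mono power_mono) (use t ut in auto)
  have Tp: "0 < T (Suc n)" for n
    unfolding T_def by (rule sum_pos_of_first) (use t1 in auto)
  have Qp: "0 < Q (Suc n)" for n using Tp[of n] TQ[of "Suc n"] by linarith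
  have b0: "0 \<le> b n" for n by (simp add: b_def)
  have "decseq b"
    unfolding decseq_Suc_iff b_def by (auto intro!: divide_left_mono mult_pos_pos)
  hence "0 \<le> (\<Sum>n<N. ((sqrt (Q (Suc n)) - sqrt (T (Suc n))) - (sqrt (Q n) - sqrt (T n))) * b n)"
    using TQ b0
    by (intro order_trans[OF _ sum_increments_mult_decseq_ge
          [where d = "\<lambda>n. sqrt (Q n) - sqrt (T n)"]]) (auto simp: T_def Q_def)
  hence mono: "(\<Sum>n<N. (sqrt (T (Suc n)) - sqrt (T n)) * b n)
      \<le> (\<Sum>n<N. (sqrt (Q (Suc n)) - sqrt (Q n)) * b n)"
    by (simp add: algebra_simps sum.distrib sum_subtractf)
  have "(\<Sum>n<N. (t (Suc n))\<^sup>2 / sqrt (real (Suc n) * T (Suc n)))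
      = (\<Sum>n<N. (t (Suc n))\<^sup>2 / sqrt (T (Suc n)) * b n)"
    by (simp add: b_def real_sqrt_mult mult.commute)
  also have "\<dots> \<le> (\<Sum>n<N. 2 * (sqrt (T (Suc n)) - sqrt (T n)) * b n)"
    unfolding TS
    by (intro sum_mono mult_right_mono sqrt_increment_bounds T0 b0) (use Tp TS in auto)
  also have "\<dots> = 2 * (\<Sum>n<N. (sqrt (T (Suc n)) - sqrt (T n)) * b n)"
    by (simp only: sum_distrib_left mult.assoc)
  also have "\<dots> \<le> 2 * (\<Sum>n<N. (sqrt (Q (Suc n)) - sqrt (Q n)) * b n)"
    using mono by simp
  also have "\<dots> \<le> 2 * (\<Sum>n<N. (u (Suc n))\<^sup>2 / sqrt (Q (Suc n)) * b n)"
    unfolding QS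
    by (intro mult_left_mono sum_mono mult_right_mono sqrt_increment_bounds Q0 b0)
      (use Qp QS in auto)
  also have "\<dots> = 2 * (\<Sum>n<N. (u (Suc n))\<^sup>2 / sqrt (real (Suc n) * Q (Suc n)))"
    by (simp add: b_def real_sqrt_mult mult.commute)
  finally show ?thesis by (simp only: T_def Q_def)
qed

lemma sum_le_sqrt_card_mult_sum_squares:
  fixes u :: "nat \<Rightarrow> real"
  shows "(\<Sum>k=1..n. u k) \<le> sqrt (real n * (\<Sum>k=1..n. (u k)\<^sup>2))"
  using sum_squared_le_sum_of_squares[of u "{1..n}"]
  by (intro real_le_rsqrt) (simp add: mult.commute)

lemma explicit_sum_eq:
  assumes t1: "0 < t 1"
  shows "explicit_sum t =
    (\<Sum>n. ennreal ((t (Suc n))\<^sup>2 / sqrt (real (Suc n) * (\<Sum>k=1..Suc n. (t k)\<^sup>2))))"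
proof -
  have "(real (Suc n) * (\<Sum>k=1..Suc n. (t k)\<^sup>2)) powr (-1/2) * (t (Suc n))\<^sup>2
      = (t (Suc n))\<^sup>2 / sqrt (real (Suc n) * (\<Sum>k=1..Suc n. (t k)\<^sup>2))" for n
  proof -
    have "0 < (\<Sum>k=1..Suc n. (t k)\<^sup>2)"
      by (rule sum_pos_of_first) (use t1 in auto)
    hence "0 < real (Suc n) * (\<Sum>k=1..Suc n. (t k)\<^sup>2)"
      by (rule mult_pos_pos[rotated]) simp
    from powr_minus_half[OF this] show ?thesis
      by (simp only: times_divide_eq_left mult_1_left)
  qed
  note term_eq = this
  show ?thesis
    unfolding explicit_sum_def term_eq ..
qed

lemma half_explicit_sum_le_majorant_inf:
  assumes t: "\<forall>k\<ge>1. 0 \<le> t k" and t1: "0 < t 1"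
  shows "ennreal (1/2) * explicit_sum t \<le> majorant_inf t"
  unfolding majorant_inf_def
proof (intro INF_greatest ennreal_half_mult_le)
  fix u :: "nat \<Rightarrow> real"
  assume "u \<in> {u. \<forall>n\<ge>1. t n \<le> u n}"
  hence ut: "t n \<le> u n" if "1 \<le> n" for n using that by blast
  have u0: "0 \<le> u n" if "1 \<le> n" for n
    by (rule order_trans[OF _ ut[OF that]]) (use t that in blast)
  define T Q U where "T n = (\<Sum>k=1..n. (t k)\<^sup>2)" and "Q n = (\<Sum>k=1..n. (u k)\<^sup>2)"
    and "U n = (\<Sum>k=1..n. u k)" for n
  have Upos: "0 < U (Suc n)" for n
    unfolding U_def by (rule sum_pos_of_first) (use u0 ut[of 1] t1 in auto)
  have UQ: "U n \<le> sqrt (real n * Q n)" for n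
    unfolding U_def Q_def by (rule sum_le_sqrt_card_mult_sum_squares)
  have "(\<Sum>n. ennreal ((t (Suc n))\<^sup>2 / sqrt (real (Suc n) * T (Suc n))))
    \<le> ennreal 2 * (\<Sum>n. ennreal (inverse (U (Suc n)) * (u (Suc n))\<^sup>2))"
  proof (rule suminf_ennreal_le_cmult)
    fix N
    have "(\<Sum>n<N. (t (Suc n))\<^sup>2 / sqrt (real (Suc n) * T (Suc n)))
      \<le> 2 * (\<Sum>n<N. (u (Suc n))\<^sup>2 / sqrt (real (Suc n) * Q (Suc n)))"
      unfolding T_def Q_def by (rule explicit_partial_sum_quasi_mono) (use t t1 ut in auto)
    also have "\<dots> \<le> 2 * (\<Sum>n<N. inverse (U (Suc n)) * (u (Suc n))\<^sup>2)"
    proof (intro mult_left_mono sum_mono)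
      fix n
      have "(u (Suc n))\<^sup>2 / sqrt (real (Suc n) * Q (Suc n)) \<le> (u (Suc n))\<^sup>2 / U (Suc n)"
        by (intro frac_le UQ Upos) simp_all
      thus "(u (Suc n))\<^sup>2 / sqrt (real (Suc n) * Q (Suc n))
        \<le> inverse (U (Suc n)) * (u (Suc n))\<^sup>2"
        unfolding divide_inverse_commute[of _ "U (Suc n)"] .
    qed simp
    finally show "(\<Sum>n<N. (t (Suc n))\<^sup>2 / sqrt (real (Suc n) * T (Suc n)))
      \<le> 2 * (\<Sum>n<N. inverse (U (Suc n)) * (u (Suc n))\<^sup>2)" .
  next
    fix n
    have "0 \<le> T (Suc n)" unfolding T_def by (rule sum_nonneg) simp
    thus "0 \<le> (t (Suc n))\<^sup>2 / sqrt (real (Suc n) * T (Suc n))" by simp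
    show "0 \<le> inverse (U (Suc n)) * (u (Suc n))\<^sup>2" using Upos[of n] by simp
  qed simp
  thus "explicit_sum t \<le> ennreal 2 * (\<Sum>n. ennreal (inverse (\<Sum>k=1..Suc n. u k) * (u (Suc n))\<^sup>2))"
    unfolding T_def U_def explicit_sum_eq[of t, OF t1] .
qed

section \<open>Superposing profiles to build a majorant\<close>

text \<open>
  This is $\varphi(k/m)$ for $\varphi(x) = \min(x, x^{-1/2})$.  The decay $x^{-1/2}$ is the
  power whose partial sums grow like $\sqrt{n}$, the rate needed in $\sqrt{n T_n}$.  The linear
  growth before the peak keeps the cost of the initial part bounded; continuing the power $x^{-1/2}$
  down to small $x$ would make the first few entries too expensive.
\<close>

definition profile :: "nat \<Rightarrow> nat \<Rightarrow> real" where
  "profile m k = (if k \<le> m then real k / real m else sqrt (real m / real k))"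

lemma profile_nonneg: "0 \<le> profile m k"
  by (simp add: profile_def)

lemma profile_le_1: "profile m k \<le> 1"
  by (auto simp: profile_def divide_le_eq_1)

lemma sum_profile_below: "n \<le> m \<Longrightarrow> (\<Sum>k=1..n. profile m k) = real n * (real n + 1) / (2 * real m)"
  by (induction n) (auto simp: profile_def field_simps)

text \<open>
  On $k \le n$ with $n \ge m$ the profile dominates the linear function
  $\sqrt{m/n} \cdot k/n$, which already has a sum of the right size.
\<close>

lemma sum_profile_above:
  assumes "1 \<le> m" "m \<le> n"
  shows "sqrt (real m * real n) / 2 \<le> (\<Sum>k=1..n. profile m k)"
proof -
  have n: "0 < real n" using assms by simp
  have *: "sqrt (real m / real n) / real n * real k \<le> profile m k" if k: "k \<in> {1..n}" for k
  proof (cases "k \<le> m")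
    case True
    have "sqrt (real m / real n) / real n * real k \<le> 1 / real m * real k"
      using assms by (intro mult_right_mono frac_le) (auto simp: divide_le_eq_1)
    thus ?thesis using True by (simp add: profile_def)
  next
    case False
    have "sqrt (real m / real n) * (real k / real n) \<le> sqrt (real m / real n) * 1"
      using k by (intro mult_left_mono) (auto simp: divide_le_eq_1)
    also have "\<dots> \<le> sqrt (real m / real k)"
      using k assms by (auto intro!: divide_left_mono)
    finally show ?thesis using False by (simp add: profile_def)
  qed
  have g: "(\<Sum>k=1..n. real k) = real n * (real n + 1) / 2"
    by (induction n) (auto simp: field_simps)
  have "sqrt (real m * real n) / 2 = sqrt (real m / real n) / real n * (real n * real n / 2)"
  proof -
    have "sqrt (real m * real n) = sqrt (real m / real n * (real n)\<^sup>2)"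
      using n by (simp add: power2_eq_square)
    also have "\<dots> = sqrt (real m / real n) * real n"
      unfolding real_sqrt_mult by simp
    finally show ?thesis using n by simp
  qed
  also have "\<dots> \<le> sqrt (real m / real n) / real n * (\<Sum>k=1..n. real k)"
    unfolding g by (intro mult_left_mono) (auto simp: field_simps)
  also have "\<dots> \<le> (\<Sum>k=1..n. profile m k)"
    unfolding sum_distrib_left by (intro sum_mono *)
  finally show ?thesis .
qed

text \<open>
  The discrete form of $\int x^{-3/2}\,dx = -2 x^{-1/2}$, used to telescope the tail of the cost.
\<close>

lemma three_halves_power_le_increment:
  fixes x :: real
  assumes "0 < x"
  shows "1 / ((x + 1) * sqrt (x + 1)) \<le> 2 * (1 / sqrt x - 1 / sqrt (x + 1))"
proof -
  define p q where "p = sqrt x" and "q = sqrt (x + 1)"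
  have pq: "0 < p" "p \<le> q" "0 < q" using assms by (auto simp: p_def q_def)
  have q2: "x + 1 = q * q" using assms by (simp add: q_def)
  have one: "1 = (q - p) * (q + p)"
    using assms by (simp add: p_def q_def algebra_simps)
  have "p \<le> 2 * (q - p) * (q * q)"
  proof -
    have "p = p * ((q - p) * (q + p))" using one by simp
    also have "\<dots> \<le> q * ((q - p) * (2 * q))"
      using pq by (intro mult_mono) (auto intro!: mult_nonneg_nonneg)
    finally show ?thesis by (simp add: mult_ac)
  qed
  thus ?thesis
    unfolding p_def[symmetric] q_def[symmetric] q2
    using pq by (simp add: field_simps)
qed

text \<open>
  Up to the peak each of the $m$ terms is at most $2/m$.  Beyond it the terms are at most
  $2 \sqrt m\, n^{-3/2}$, with sum at most $4$.
\<close>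

lemma profile_cost_bound:
  assumes m: "1 \<le> m"
  shows "(\<Sum>n=1..N. (profile m n)\<^sup>2 / (\<Sum>k=1..n. profile m k)) \<le> 6"
proof -
  define r where "r n = (profile m n)\<^sup>2 / (\<Sum>k=1..n. profile m k)" for n
  have r0: "0 \<le> r n" for n
    unfolding r_def by (intro divide_nonneg_nonneg sum_nonneg profile_nonneg) simp
  have low: "r n \<le> 2 / real m" if "1 \<le> n" "n \<le> m" for n
  proof -
    have "r n = 2 / real m * (real n / (real n + 1))"
    proof -
      have "(x / y)\<^sup>2 / (x * (x + 1) / (2 * y)) = 2 / y * (x / (x + 1))"
        if "0 < x" "0 < y" "0 < x + 1" for x y :: real
        using that by (simp add: divide_simps power2_eq_square)
      thus ?thesis
        unfolding r_def sum_profile_below[OF that(2)] using that m by (simp add: profile_def)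
    qed
    also have "\<dots> \<le> 2 / real m * 1"
      by (intro mult_left_mono) (auto simp: divide_le_eq_1)
    finally show ?thesis by simp
  qed
  have sum_low: "(\<Sum>n=1..M. r n) \<le> 2" if "M \<le> m" for M
  proof -
    have "(\<Sum>n=1..M. r n) \<le> (\<Sum>n=1..M. 2 / real m)"
      by (intro sum_mono low) (use that in auto)
    also have "\<dots> \<le> 2" using that m by (simp add: field_simps)
    finally show ?thesis .
  qed
  have high: "r (Suc n) \<le> 4 * sqrt (real m) * (1 / sqrt (real n) - 1 / sqrt (real (Suc n)))"
    if "m \<le> n" for n
  proof -
    have n: "0 < real n" using that m by simp
    have "r (Suc n) \<le> (real m / real (Suc n)) / (sqrt (real m * real (Suc n)) / 2)"
      unfolding r_def
    proof (rule frac_le)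
      show "sqrt (real m * real (Suc n)) / 2 \<le> (\<Sum>k=1..Suc n. profile m k)"
        by (rule sum_profile_above) (use m that in auto)
    qed (use m that in \<open>auto simp: profile_def\<close>)
    also have "\<dots> = 2 * sqrt (real m) * (1 / ((real n + 1) * sqrt (real n + 1)))"
    proof -
      have "(p * p / x) / (p * q / 2) = 2 * p * (1 / (x * q))" if "0 < p" "0 < q" "0 < x"
        for p q x :: real
        using that by (simp add: divide_simps)
      from this[of "sqrt (real m)" "sqrt (real n + 1)" "real n + 1"] show ?thesis
        using m by (simp add: real_sqrt_mult add.commute)
    qed
    also have "\<dots> \<le> 2 * sqrt (real m) * (2 * (1 / sqrt (real n) - 1 / sqrt (real n + 1)))"
      by (intro mult_left_mono three_halves_power_le_increment n) simp
    finally show ?thesis by (simp add: add.commute mult_ac)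
  qed
  have sum_high: "(\<Sum>n=1..M. r n) \<le> 6 - 4 * sqrt (real m) / sqrt (real M)" if "m \<le> M" for M
    using that
  proof (induction M rule: dec_induct)
    case base
    show ?case using sum_low[of m] m by simp
  next
    case (step n)
    show ?case using step.IH high[OF step.hyps(1)] by (simp add: algebra_simps)
  qed
  have "(\<Sum>n=1..N. r n) \<le> 6"
  proof (cases "m \<le> N")
    case True
    have "0 \<le> 4 * sqrt (real m) / sqrt (real N)" by simp
    thus ?thesis using sum_high[OF True] by linarith
  next
    case False
    thus ?thesis using sum_low[of N] by linarith
  qed
  thus ?thesis by (simp add: r_def)
qed

text \<open>
  Countable subadditivity of the convex, positively homogeneous function $x^2/y$.  As
  $x^2/y = \max_\lambda (2 \lambda x - \lambda^2 y)$, it suffices to sum the linear minorants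
  $2 \lambda x_i - \lambda^2 y_i \le x_i^2/y_i$ for the $\lambda = X/Y$ that is optimal for the total.
\<close>

lemma square_suminf_div_suminf_le:
  fixes x y :: "nat \<Rightarrow> real"
  assumes y: "\<And>i. 0 < y i"
    and sx: "summable (\<lambda>i. w i * x i)" and sy: "summable (\<lambda>i. w i * y i)"
    and sr: "summable (\<lambda>i. w i * ((x i)\<^sup>2 / y i))" and w: "\<And>i. 0 \<le> w i"
  shows "(\<Sum>i. w i * x i)\<^sup>2 / (\<Sum>i. w i * y i) \<le> (\<Sum>i. w i * ((x i)\<^sup>2 / y i))"
proof -
  define X Y where "X = (\<Sum>i. w i * x i)" and "Y = (\<Sum>i. w i * y i)"
  define l where "l = X / Y"
  have "w i * (2 * l * x i - l\<^sup>2 * y i) \<le> w i * ((x i)\<^sup>2 / y i)" for i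
  proof (rule mult_left_mono[OF _ w])
    have "0 \<le> (x i - l * y i)\<^sup>2 / y i" using y[of i] by simp
    also have "\<dots> = (x i)\<^sup>2 / y i - (2 * l * x i - l\<^sup>2 * y i)"
      using y[of i] by (simp add: field_simps power2_eq_square)
    finally show "2 * l * x i - l\<^sup>2 * y i \<le> (x i)\<^sup>2 / y i" by simp
  qed
  moreover have lin: "(\<lambda>i. w i * (2 * l * x i - l\<^sup>2 * y i)) sums (2 * l * X - l\<^sup>2 * Y)"
  proof -
    have "(\<lambda>i. 2 * l * (w i * x i) - l\<^sup>2 * (w i * y i)) sums (2 * l * X - l\<^sup>2 * Y)"
      unfolding X_def Y_def by (intro sums_diff sums_mult summable_sums sx sy)
    thus ?thesis by (simp add: algebra_simps)
  qed
  ultimately have "2 * l * X - l\<^sup>2 * Y \<le> (\<Sum>i. w i * ((x i)\<^sup>2 / y i))"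
    using sr by (metis (no_types, lifting) suminf_le sums_iff)
  moreover have "2 * l * X - l\<^sup>2 * Y = X\<^sup>2 / Y"
    by (cases "Y = 0") (simp_all add: l_def field_simps power2_eq_square)
  ultimately show ?thesis by (simp add: X_def Y_def)
qed

text \<open>
  The two properties that the majorant needs, growth of the partial sums and an upper bound for the
  cost, pass from single profiles to superpositions with summable weights: the first
  is linear, the second is subadditive.  The weight $w_i$ belongs to the peak $i + 1$.
\<close>

lemma superposed_profiles:
  fixes w :: "nat \<Rightarrow> real"
  assumes w: "\<And>i. 0 \<le> w i" and sw: "summable w"
  defines "v \<equiv> \<lambda>k. \<Sum>i. w i * profile (Suc i) k"
  shows "0 \<le> v k"
    and "sqrt (real n) / 2 * (\<Sum>i<n. w i * sqrt (real (Suc i))) \<le> (\<Sum>k=1..n. v k)"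
    and "(\<Sum>n=1..N. (v n)\<^sup>2 / (\<Sum>k=1..n. v k)) \<le> 6 * suminf w"
proof -
  have sp: "summable (\<lambda>i. w i * profile (Suc i) k)" for k
  proof (rule summable_comparison_test'[OF sw])
    fix i
    show "norm (w i * profile (Suc i) k) \<le> w i"
      using mult_left_mono[OF profile_le_1 w] w profile_nonneg by (simp add: abs_mult)
  qed
  show "0 \<le> v k"
    unfolding v_def by (intro suminf_nonneg sp mult_nonneg_nonneg w profile_nonneg)
  define \<Phi> where "\<Phi> i n = (\<Sum>k=1..n. profile (Suc i) k)" for i n
  have \<Phi>0: "0 \<le> \<Phi> i n" for i n unfolding \<Phi>_def by (intro sum_nonneg profile_nonneg)
  have s\<Phi>: "summable (\<lambda>i. w i * \<Phi> i n)" for n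
    unfolding \<Phi>_def sum_distrib_left by (intro summable_sum sp)
  have V: "(\<Sum>k=1..n. v k) = (\<Sum>i. w i * \<Phi> i n)" for n
    unfolding \<Phi>_def sum_distrib_left v_def by (intro suminf_sum[symmetric] sp)
  show "sqrt (real n) / 2 * (\<Sum>i<n. w i * sqrt (real (Suc i))) \<le> (\<Sum>k=1..n. v k)"
  proof -
    have "sqrt (real n) / 2 * (\<Sum>i<n. w i * sqrt (real (Suc i)))
        = (\<Sum>i<n. w i * (sqrt (real (Suc i) * real n) / 2))"
      by (simp add: sum_distrib_left real_sqrt_mult mult_ac)
    also have "\<dots> \<le> (\<Sum>i<n. w i * \<Phi> i n)"
      unfolding \<Phi>_def by (intro sum_mono mult_left_mono w sum_profile_above) auto
    also have "\<dots> \<le> (\<Sum>i. w i * \<Phi> i n)"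
      by (intro sum_le_suminf s\<Phi>) (auto intro!: mult_nonneg_nonneg w \<Phi>0)
    finally show ?thesis unfolding V .
  qed
  have \<Phi>pos: "0 < \<Phi> i n" if "1 \<le> n" for i n
    unfolding \<Phi>_def
    by (rule sum_pos_of_first) (use that in \<open>auto simp: profile_nonneg profile_def\<close>)
  have sr: "summable (\<lambda>i. w i * ((profile (Suc i) n)\<^sup>2 / \<Phi> i n))" if n: "1 \<le> n" for n
  proof (rule summable_comparison_test'[OF sp[of n]])
    fix i
    have "profile (Suc i) n \<le> \<Phi> i n"
      unfolding \<Phi>_def by (rule member_le_sum) (use n profile_nonneg in auto)
    hence "profile (Suc i) n * profile (Suc i) n \<le> profile (Suc i) n * \<Phi> i n"
      by (intro mult_left_mono profile_nonneg)
    hence "(profile (Suc i) n)\<^sup>2 / \<Phi> i n \<le> profile (Suc i) n"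
      using \<Phi>pos[OF n, of i] by (simp add: field_simps power2_eq_square)
    from mult_left_mono[OF this w[of i]]
    show "norm (w i * ((profile (Suc i) n)\<^sup>2 / \<Phi> i n)) \<le> w i * profile (Suc i) n"
      using w[of i] \<Phi>0[of i n] by (simp add: abs_mult)
  qed
  have "(\<Sum>n=1..N. (v n)\<^sup>2 / (\<Sum>k=1..n. v k))
      \<le> (\<Sum>n=1..N. \<Sum>i. w i * ((profile (Suc i) n)\<^sup>2 / \<Phi> i n))"
    unfolding V unfolding v_def
    by (intro sum_mono square_suminf_div_suminf_le sp s\<Phi> sr w \<Phi>pos) auto
  also have "\<dots> = (\<Sum>i. \<Sum>n=1..N. w i * ((profile (Suc i) n)\<^sup>2 / \<Phi> i n))"
    by (intro suminf_sum[symmetric] sr) simp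
  also have "\<dots> \<le> (\<Sum>i. w i * 6)"
  proof (rule suminf_le)
    fix i
    show "(\<Sum>n=1..N. w i * ((profile (Suc i) n)\<^sup>2 / \<Phi> i n)) \<le> w i * 6"
      unfolding sum_distrib_left[symmetric] \<Phi>_def
      by (intro mult_left_mono w profile_cost_bound) simp
  next
    show "summable (\<lambda>i. \<Sum>n=1..N. w i * ((profile (Suc i) n)\<^sup>2 / \<Phi> i n))"
      by (intro summable_sum sr) simp
    show "summable (\<lambda>i. w i * 6)" by (rule summable_mult2[OF sw])
  qed
  also have "\<dots> = 6 * suminf w"
    using suminf_mult2[OF sw, of 6] by (simp add: mult.commute)
  finally show "(\<Sum>n=1..N. (v n)\<^sup>2 / (\<Sum>k=1..n. v k)) \<le> 6 * suminf w" .
qed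

text \<open>
  The majorant is $u = t + v$ with $v$ the superposition of profiles weighted by the terms of the
  explicit sum.  By $(t + v)^2 \le 2 t^2 + 2 v^2$ and $U_n \ge V_n \ge \frac12 \sqrt{n T_n}$ the cost is
  at most $2 \cdot 2E + 2 \cdot 6E$.
\<close>

lemma majorant_inf_le_explicit_sum:
  assumes t: "\<forall>k\<ge>1. 0 \<le> t k" and t1: "0 < t 1"
  shows "majorant_inf t \<le> ennreal 16 * explicit_sum t"
proof (cases "explicit_sum t = \<infinity>")
  case True
  thus ?thesis by (simp add: ennreal_mult_top)
next
  case False
  define T where "T n = (\<Sum>k=1..n. (t k)\<^sup>2)" for n
  have Tp: "0 < T n" if "1 \<le> n" for n
    unfolding T_def by (rule sum_pos_of_first) (use t1 that in auto)
  have Tmono: "T k \<le> T n" if "k \<le> n" for k n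
    unfolding T_def by (rule sum_mono2) (use that in auto)
  define w where "w n = (t (Suc n))\<^sup>2 / sqrt (real (Suc n) * T (Suc n))" for n
  have w0: "0 \<le> w n" for n
    unfolding w_def using Tp[of "Suc n"] by (intro divide_nonneg_nonneg) simp_all
  have E: "explicit_sum t = (\<Sum>n. ennreal (w n))"
    unfolding explicit_sum_eq[of t, OF t1] w_def T_def ..
  have sw: "summable w"
    using False w0 unfolding E by (intro summable_suminf_not_top) auto
  have E': "explicit_sum t = ennreal (suminf w)"
    unfolding E by (rule suminf_ennreal2[OF w0 sw])
  define v where "v k = (\<Sum>i. w i * profile (Suc i) k)" for k
  define V where "V n = (\<Sum>k=1..n. v k)" for n
  have v0: "0 \<le> v k" for k
    unfolding v_def by (rule superposed_profiles(1)[OF w0 sw])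
  have V_ge: "sqrt (real n * T n) / 2 \<le> V n" if n: "1 \<le> n" for n
  proof -
    have "sqrt (T n) = (\<Sum>i<n. (t (Suc i))\<^sup>2) / sqrt (T n)"
    proof -
      have "(\<Sum>i<n. (t (Suc i))\<^sup>2) = T n"
        unfolding T_def by (simp add: sum.atLeast1_atMost_eq)
      thus ?thesis using Tp[OF n] by (simp add: real_div_sqrt)
    qed
    also have "\<dots> \<le> (\<Sum>i<n. (t (Suc i))\<^sup>2 / sqrt (T (Suc i)))"
      unfolding sum_divide_distrib
      by (intro sum_mono divide_left_mono real_sqrt_le_mono Tmono mult_pos_pos)
        (use Tp n in auto)
    also have "\<dots> = (\<Sum>i<n. w i * sqrt (real (Suc i)))"
      unfolding w_def by (simp add: real_sqrt_mult)
    finally have "sqrt (real n) / 2 * sqrt (T n)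
        \<le> sqrt (real n) / 2 * (\<Sum>i<n. w i * sqrt (real (Suc i)))"
      by (intro mult_left_mono) auto
    also have "\<dots> \<le> V n"
      unfolding V_def v_def by (rule superposed_profiles(2)[OF w0 sw])
    finally show ?thesis by (simp add: real_sqrt_mult)
  qed
  define u where "u k = t k + v k" for k
  define U where "U n = (\<Sum>k=1..n. u k)" for n
  have Vp: "0 < V n" if "1 \<le> n" for n
  proof -
    have "0 < sqrt (real n * T n) / 2" using Tp[OF that] that by simp
    thus ?thesis using V_ge[OF that] by linarith
  qed
  have UV: "V n \<le> U n" for n
    unfolding U_def V_def u_def by (intro sum_mono) (use t in auto)
  have cost_le: "inverse (U (Suc n)) * (u (Suc n))\<^sup>2
      \<le> 4 * w n + 2 * ((v (Suc n))\<^sup>2 / V (Suc n))" for n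
  proof -
    let ?k = "Suc n"
    have "inverse (U ?k) * (u ?k)\<^sup>2 \<le> inverse (V ?k) * (2 * (t ?k)\<^sup>2 + 2 * (v ?k)\<^sup>2)"
    proof (rule mult_mono)
      show "inverse (U ?k) \<le> inverse (V ?k)"
        using Vp[of ?k] UV[of ?k] by (intro le_imp_inverse_le) auto
      show "(u ?k)\<^sup>2 \<le> 2 * (t ?k)\<^sup>2 + 2 * (v ?k)\<^sup>2"
        using sum_squares_bound[of "t ?k" "v ?k"] by (simp add: u_def power2_sum)
      show "0 \<le> inverse (V ?k)" using Vp[of ?k] by simp
    qed simp
    also have "\<dots> = 2 * ((t ?k)\<^sup>2 / V ?k) + 2 * ((v ?k)\<^sup>2 / V ?k)"
      by (simp add: divide_inverse algebra_simps)
    also have "(t ?k)\<^sup>2 / V ?k \<le> (t ?k)\<^sup>2 / (sqrt (real ?k * T ?k) / 2)"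
      by (rule divide_left_mono[OF V_ge])
        (use Vp[of ?k] Tp[of ?k] in \<open>auto intro!: mult_pos_pos\<close>)
    also have "\<dots> = 2 * w n" by (simp add: w_def)
    finally show ?thesis by simp
  qed
  have "majorant_inf t \<le> (\<Sum>n. ennreal (inverse (U (Suc n)) * (u (Suc n))\<^sup>2))"
    unfolding majorant_inf_def U_def by (intro INF_lower) (use v0 in \<open>auto simp: u_def\<close>)
  also have "\<dots> \<le> ennreal (16 * suminf w)"
  proof (rule suminf_ennreal_le_of_partial_sums)
    fix n
    show "0 \<le> inverse (U (Suc n)) * (u (Suc n))\<^sup>2"
      using Vp[of "Suc n"] UV[of "Suc n"] by simp
  next
    fix N
    have "(\<Sum>n<N. inverse (U (Suc n)) * (u (Suc n))\<^sup>2)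
        \<le> (\<Sum>n<N. 4 * w n + 2 * ((v (Suc n))\<^sup>2 / V (Suc n)))"
      by (intro sum_mono cost_le)
    also have "\<dots> = 4 * (\<Sum>n<N. w n) + 2 * (\<Sum>n=1..N. (v n)\<^sup>2 / V n)"
      by (simp add: sum.distrib sum_distrib_left sum.atLeast1_atMost_eq)
    also have "(\<Sum>n<N. w n) \<le> suminf w"
      by (intro sum_le_suminf sw w0) auto
    also have "(\<Sum>n=1..N. (v n)\<^sup>2 / V n) \<le> 6 * suminf w"
      unfolding V_def v_def by (rule superposed_profiles(3)[OF w0 sw])
    finally have "(\<Sum>n<N. inverse (U (Suc n)) * (u (Suc n))\<^sup>2) \<le> 16 * suminf w"
      by simp
    thus "ennreal (\<Sum>n<N. inverse (U (Suc n)) * (u (Suc n))\<^sup>2) \<le> ennreal (16 * suminf w)"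
      by (rule ennreal_leI)
  qed
  also have "\<dots> = ennreal 16 * explicit_sum t"
    unfolding E' by (rule ennreal_mult) (use suminf_nonneg[OF sw w0] in auto)
  finally show ?thesis .
qed

theorem theorem3:
  "\<exists>c C :: real. 0 < c \<and> c \<le> C \<and>
     (\<forall>t :: nat \<Rightarrow> real.
        (\<forall>k\<ge>1. 0 \<le> t k \<and> t k \<le> 1) \<longrightarrow> t 1 > 0 \<longrightarrow>
        comparable c C (product_inf t) (majorant_inf t) \<and>
        comparable c C (majorant_inf t) (explicit_sum t))"
proof (rule exI[of _ "1/2"], rule exI[of _ 16], intro conjI allI impI)
  fix t :: "nat \<Rightarrow> real"
  assume "\<forall>k\<ge>1. 0 \<le> t k \<and> t k \<le> 1" and t1: "t 1 > 0"
  hence t: "\<forall>k\<ge>1. 0 \<le> t k" by blast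
  have "product_inf t \<le> ennreal 1 * majorant_inf t"
    using product_inf_le_majorant_inf[OF t t1] by simp
  also have "\<dots> \<le> ennreal 16 * majorant_inf t"
    by (intro mult_right_mono ennreal_leI) simp_all
  finally show "comparable (1/2) 16 (product_inf t) (majorant_inf t)"
    unfolding comparable_def
    using half_majorant_inf_le_product_inf[OF t t1] by blast
  show "comparable (1/2) 16 (majorant_inf t) (explicit_sum t)"
    unfolding comparable_def
    using half_explicit_sum_le_majorant_inf[OF t t1]
      majorant_inf_le_explicit_sum[OF t t1] by blast
qed simp_all

end
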